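(* Let $\phi:\mathbb{U}\to\mathbb{U}$ be analytic and let $\psi$ be analytic on $\mathbb{U}$ such that $W_{\psi,\phi}$ is bounded on $H^2(\mathbb{U})$. Suppose $W_{\psi,\phi}$ is normal. If $\phi$ is not a constant function and $\psi$ is not the zero function, then $\phi$ is univalent (injective) on $\mathbb{U}$.
   Context: $\mathbb{U}$ is the open unit disc in $\mathbb{C}$. $H^2(\mathbb{U})$ is the Hardy space of analytic functions on $\mathbb{U}$ with square-summable Maclaurin coefficients, a Hilbert space with inner product $\langle f,g\rangle=\sum_{n\ge 0}\hat f(n)\overline{\hat g(n)}$, where $\hat f(n)$ are the Maclaurin coefficients. The weighted composition operator is $W_{\psi,\phi}f=\psi\cdot(f\circ\phi)$. *)

theory Defs
  imports "HOL-Complex_Analysis.Complex_Analysis"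
begin

abbreviation unit_disc :: "complex set" where
  "unit_disc \<equiv> ball 0 1"

definition maclaurin_coeff :: "(complex \<Rightarrow> complex) \<Rightarrow> nat \<Rightarrow> complex" where
  "maclaurin_coeff f n = (deriv ^^ n) f 0 / fact n"

(* Elements are total functions that are undefined off the disc, so that equality in HOL
   is equality of functions on the disc. *)
definition H2 :: "(complex \<Rightarrow> complex) set" where
  "H2 = {f \<in> extensional unit_disc.
           f holomorphic_on unit_disc \<and> summable (\<lambda>n. (cmod (maclaurin_coeff f n))\<^sup>2)}"

definition h2_inner :: "(complex \<Rightarrow> complex) \<Rightarrow> (complex \<Rightarrow> complex) \<Rightarrow> complex" where
  "h2_inner f g = (\<Sum>n. maclaurin_coeff f n * cnj (maclaurin_coeff g n))"

definition h2_norm :: "(complex \<Rightarrow> complex) \<Rightarrow> real" where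
  "h2_norm f = sqrt (\<Sum>n. (cmod (maclaurin_coeff f n))\<^sup>2)"

definition weighted_comp_op ::
    "(complex \<Rightarrow> complex) \<Rightarrow> (complex \<Rightarrow> complex) \<Rightarrow> (complex \<Rightarrow> complex) \<Rightarrow> (complex \<Rightarrow> complex)" where
  "weighted_comp_op \<psi> \<phi> f = (\<lambda>z\<in>unit_disc. \<psi> z * f (\<phi> z))"

definition h2_bounded :: "((complex \<Rightarrow> complex) \<Rightarrow> (complex \<Rightarrow> complex)) \<Rightarrow> bool" where
  "h2_bounded T \<longleftrightarrow> T \<in> H2 \<rightarrow> H2 \<and> (\<exists>C. \<forall>f\<in>H2. h2_norm (T f) \<le> C * h2_norm f)"

(* The description is proper (Riesz representation) for bounded linear T and g in H2. *)
definition h2_adjoint ::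
    "((complex \<Rightarrow> complex) \<Rightarrow> (complex \<Rightarrow> complex)) \<Rightarrow> (complex \<Rightarrow> complex) \<Rightarrow> (complex \<Rightarrow> complex)" where
  "h2_adjoint T g = (THE h. h \<in> H2 \<and> (\<forall>f\<in>H2. h2_inner (T f) g = h2_inner f h))"

definition h2_normal :: "((complex \<Rightarrow> complex) \<Rightarrow> (complex \<Rightarrow> complex)) \<Rightarrow> bool" where
  "h2_normal T \<longleftrightarrow> (\<forall>f\<in>H2. T (h2_adjoint T f) = h2_adjoint T (T f))"

end

theory Submission
  imports Defs
begin

text \<open>
  Since \<open>\<phi>\<close> is nonconstant and \<open>\<psi>\<close> is not zero, \<open>T = W\<^sub>\<psi>\<^sub>,\<^sub>\<phi>\<close> is injective by the open mapping
  and identity theorems; normality then makes \<open>T\<^sup>*\<close> injective. With \<open>K\<^sub>w\<close> the reproducing kernel,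
  \<open>T\<^sup>* K\<^sub>w\<close> is the multiple of \<open>K\<close> at \<open>\<phi> w\<close> by the conjugate of \<open>\<psi> w\<close>. Injectivity of \<open>T\<^sup>*\<close>
  forces \<open>\<psi>\<close> to have no zeros, and if \<open>\<phi> a = \<phi> b\<close> it makes \<open>K\<^sub>a\<close> and \<open>K\<^sub>b\<close> linearly
  dependent, hence \<open>a = b\<close>.
\<close>

section \<open>Power series with square-summable coefficients\<close>

definition h2_series :: "(nat \<Rightarrow> complex) \<Rightarrow> complex \<Rightarrow> complex" where
  "h2_series a = (\<lambda>z\<in>unit_disc. \<Sum>n. a n * z ^ n)"

lemma maclaurin_coeff_sums:
  assumes "f holomorphic_on unit_disc" "z \<in> unit_disc"
  shows "(\<lambda>n. maclaurin_coeff f n * z ^ n) sums f z"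
  using holomorphic_power_series[OF assms] by (simp add: maclaurin_coeff_def)

text \<open>Square-summable coefficients tend to 0 and so are bounded; a geometric series then
  dominates at every radius below 1.\<close>

lemma square_summable_conv_radius:
  fixes a :: "nat \<Rightarrow> complex"
  assumes "summable (\<lambda>n. (cmod (a n))\<^sup>2)"
  shows "conv_radius a \<ge> 1"
proof -
  have "(\<lambda>n. (cmod (a n))\<^sup>2) \<longlonglongrightarrow> 0"
    using assms by (rule summable_LIMSEQ_zero)
  then have "a \<longlonglongrightarrow> 0"
    by (simp add: tendsto_norm_zero_iff)
  then have "Bseq a"
    by (intro convergent_imp_Bseq convergentI)
  then obtain M where M: "\<And>n. cmod (a n) \<le> M"
    by (auto simp: Bseq_def)
  have "summable (\<lambda>n. a n * of_real r ^ n)" if "0 < r" "r < 1" for r :: real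
  proof (rule summable_comparison_test')
    show "summable (\<lambda>n. M * r ^ n)"
      using that by (intro summable_mult summable_geometric) auto
    show "norm (a n * of_real r ^ n) \<le> M * r ^ n" if "n \<ge> 0" for n
      using M[of n] \<open>0 < r\<close> by (simp add: norm_mult norm_power mult_right_mono)
  qed
  \<comment> \<open>One point of convergence on each circle is enough, so the positive real point
    serves.\<close>
  then have "\<exists>z. norm z = r \<and> summable (\<lambda>n. a n * z ^ n)" if "0 < r" "r < 1" for r
    using that by (intro exI[of _ "complex_of_real r"]) auto
  then show ?thesis
    by (intro conv_radius_geI_ex) (auto simp: one_ereal_def)
qed

context
  fixes a :: "nat \<Rightarrow> complex"
  assumes sq: "summable (\<lambda>n. (cmod (a n))\<^sup>2)"
begin

lemma h2_series_sums:
  assumes "z \<in> unit_disc"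
  shows "(\<lambda>n. a n * z ^ n) sums h2_series a z"
proof -
  have "ereal (norm z) < 1"
    using assms by (simp add: one_ereal_def)
  then have "ereal (norm z) < conv_radius a"
    using square_summable_conv_radius[OF sq] by (rule less_le_trans)
  then show ?thesis
    using assms by (simp add: h2_series_def summable_in_conv_radius summable_sums)
qed

lemma h2_series_holomorphic: "h2_series a holomorphic_on unit_disc"
  by (rule power_series_holomorphic[where a = a]) (simp add: h2_series_sums del: mem_ball)

text \<open>Uniqueness of the power series expansion at 0. Elements of \<open>H2\<close> can
  therefore be prescribed by their coefficients.\<close>

lemma maclaurin_coeff_h2_series: "maclaurin_coeff (h2_series a) = a"
proof -
  have "1 \<le> fps_conv_radius (Abs_fps a)"
    using square_summable_conv_radius[OF sq] by (simp add: fps_conv_radius_def)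
  then have "0 < fps_conv_radius (Abs_fps a)"
    by (rule less_le_trans[rotated]) simp
  moreover have "eventually (\<lambda>z. z \<in> unit_disc) (nhds 0)"
    by (rule eventually_nhds_in_open) auto
  then have "eventually (\<lambda>z. eval_fps (Abs_fps a) z = h2_series a z) (nhds 0)"
    by eventually_elim (simp add: eval_fps_def h2_series_def)
  ultimately have "h2_series a has_fps_expansion Abs_fps a"
    by (simp add: has_fps_expansion_def)
  from fps_nth_fps_expansion[OF this] show ?thesis
    by (auto simp: maclaurin_coeff_def)
qed

lemma h2_series_in_H2: "h2_series a \<in> H2"
  unfolding H2_def
  by (simp add: h2_series_holomorphic maclaurin_coeff_h2_series sq) (simp add: h2_series_def)

end

section \<open>Linear structure and inner product of the Hardy space\<close>

lemma H2_square_summable: "f \<in> H2 \<Longrightarrow> summable (\<lambda>n. (cmod (maclaurin_coeff f n))\<^sup>2)"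
  by (simp add: H2_def)

lemma H2_sums:
  "\<lbrakk>f \<in> H2; z \<in> unit_disc\<rbrakk> \<Longrightarrow> (\<lambda>n. maclaurin_coeff f n * z ^ n) sums f z"
  by (rule maclaurin_coeff_sums) (auto simp: H2_def)

lemma H2_eqI:
  assumes "f \<in> H2" "g \<in> H2" "\<And>z. z \<in> unit_disc \<Longrightarrow> f z = g z"
  shows "f = g"
  using assms(1,2) by (intro extensionalityI[of f unit_disc g] assms(3)) (auto simp: H2_def)

lemma H2_eqI_coeff:
  assumes "f \<in> H2" "g \<in> H2" "\<And>n. maclaurin_coeff f n = maclaurin_coeff g n"
  shows "f = g"
proof (rule H2_eqI)
  fix z assume z: "z \<in> unit_disc"
  show "f z = g z"
    using H2_sums[OF assms(1) z] H2_sums[OF assms(2) z]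
    unfolding assms(3) by (rule sums_unique2)
qed (use assms in auto)

lemma square_summable_mult:
  fixes a b :: "nat \<Rightarrow> complex"
  assumes "summable (\<lambda>n. (cmod (a n))\<^sup>2)" "summable (\<lambda>n. (cmod (b n))\<^sup>2)"
  shows "summable (\<lambda>n. cmod (a n) * cmod (b n))"
proof (rule summable_comparison_test')
  show "summable (\<lambda>n. (cmod (a n))\<^sup>2 + (cmod (b n))\<^sup>2)"
    using assms by (rule summable_add)
  show "norm (cmod (a n) * cmod (b n)) \<le> (cmod (a n))\<^sup>2 + (cmod (b n))\<^sup>2" if "n \<ge> 0" for n
    using sum_squares_bound[of "cmod (a n)" "cmod (b n)"]
      mult_nonneg_nonneg[OF norm_ge_zero[of "a n"] norm_ge_zero[of "b n"]]
    unfolding real_norm_def abs_mult abs_norm_cancel mult.assoc by linarith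
qed

text \<open>Rests on \<open>(x + y)^2 \<le> 2 * x^2 + 2 * y^2\<close>, applied to the norms of the
  two summands.\<close>

lemma square_summable_add:
  fixes a b :: "nat \<Rightarrow> complex"
  assumes "summable (\<lambda>n. (cmod (a n))\<^sup>2)" "summable (\<lambda>n. (cmod (b n))\<^sup>2)"
  shows "summable (\<lambda>n. (cmod (c * a n + d * b n))\<^sup>2)"
proof (rule summable_comparison_test')
  show "summable (\<lambda>n. (2 * (cmod c)\<^sup>2) * (cmod (a n))\<^sup>2 + (2 * (cmod d)\<^sup>2) * (cmod (b n))\<^sup>2)"
    using assms by (intro summable_add summable_mult)
  show "norm ((cmod (c * a n + d * b n))\<^sup>2)
      \<le> (2 * (cmod c)\<^sup>2) * (cmod (a n))\<^sup>2 + (2 * (cmod d)\<^sup>2) * (cmod (b n))\<^sup>2" if "n \<ge> 0" for n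
  proof -
    have "cmod (c * a n + d * b n) \<le> cmod c * cmod (a n) + cmod d * cmod (b n)"
      by (metis norm_mult norm_triangle_ineq)
    then have "(cmod (c * a n + d * b n))\<^sup>2 \<le> (cmod c * cmod (a n) + cmod d * cmod (b n))\<^sup>2"
      by (intro power_mono) auto
    also have "\<dots> \<le> 2 * (cmod c * cmod (a n))\<^sup>2 + 2 * (cmod d * cmod (b n))\<^sup>2"
      using sum_squares_bound[of "cmod c * cmod (a n)" "cmod d * cmod (b n)"]
      by (simp add: power2_sum)
    finally show ?thesis by (simp add: power_mult_distrib)
  qed
qed

text \<open>The restriction keeps the result extensional, as membership in \<open>H2\<close>
  demands; a plain pointwise combination could take other values off the disc.\<close>

definition h2_lincomb ::
    "complex \<Rightarrow> (complex \<Rightarrow> complex) \<Rightarrow> complex \<Rightarrow> (complex \<Rightarrow> complex) \<Rightarrow> complex \<Rightarrow> complex" where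
  "h2_lincomb c f d g = (\<lambda>z\<in>unit_disc. c * f z + d * g z)"

lemma h2_lincomb_eq_series:
  assumes "f \<in> H2" "g \<in> H2"
  shows "h2_lincomb c f d g = h2_series (\<lambda>n. c * maclaurin_coeff f n + d * maclaurin_coeff g n)"
proof -
  have "(\<Sum>n. (c * maclaurin_coeff f n + d * maclaurin_coeff g n) * z ^ n) = c * f z + d * g z"
    if "z \<in> unit_disc" for z
    using sums_add[OF sums_mult[OF H2_sums[OF assms(1) that], of c]
        sums_mult[OF H2_sums[OF assms(2) that], of d]]
    by (simp add: sums_iff algebra_simps)
  then show ?thesis
    by (auto simp: h2_lincomb_def h2_series_def fun_eq_iff)
qed

lemma
  assumes "f \<in> H2" "g \<in> H2"
  shows h2_lincomb_in_H2: "h2_lincomb c f d g \<in> H2"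
    and maclaurin_coeff_h2_lincomb:
      "maclaurin_coeff (h2_lincomb c f d g) n = c * maclaurin_coeff f n + d * maclaurin_coeff g n"
proof -
  have *: "summable (\<lambda>n. (cmod (c * maclaurin_coeff f n + d * maclaurin_coeff g n))\<^sup>2)"
    by (intro square_summable_add H2_square_summable assms)
  show "h2_lincomb c f d g \<in> H2"
    using h2_series_in_H2[OF *] h2_lincomb_eq_series[OF assms] by simp
  show "maclaurin_coeff (h2_lincomb c f d g) n = c * maclaurin_coeff f n + d * maclaurin_coeff g n"
    using maclaurin_coeff_h2_series[OF *] h2_lincomb_eq_series[OF assms] by simp
qed

lemma h2_inner_sums:
  assumes "f \<in> H2" "g \<in> H2"
  shows "(\<lambda>n. maclaurin_coeff f n * cnj (maclaurin_coeff g n)) sums h2_inner f g"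
  unfolding h2_inner_def
  by (rule summable_sums, rule summable_norm_cancel)
    (simp add: norm_mult square_summable_mult assms H2_square_summable)

lemma h2_inner_lincomb_left:
  assumes "f \<in> H2" "g \<in> H2" "h \<in> H2"
  shows "h2_inner (h2_lincomb c f d g) h = c * h2_inner f h + d * h2_inner g h"
proof (rule sums_unique2[OF h2_inner_sums[OF h2_lincomb_in_H2[OF assms(1,2)] assms(3)]])
  show "(\<lambda>n. maclaurin_coeff (h2_lincomb c f d g) n * cnj (maclaurin_coeff h n))
      sums (c * h2_inner f h + d * h2_inner g h)"
    using sums_add[OF sums_mult[OF h2_inner_sums[OF assms(1,3)], of c]
        sums_mult[OF h2_inner_sums[OF assms(2,3)], of d]]
    by (simp add: maclaurin_coeff_h2_lincomb[OF assms(1,2)] distrib_right mult.assoc)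
qed

lemma h2_inner_commute:
  assumes "f \<in> H2" "g \<in> H2"
  shows "h2_inner g f = cnj (h2_inner f g)"
proof (rule sums_unique2[OF h2_inner_sums[OF assms(2,1)]])
  show "(\<lambda>n. maclaurin_coeff g n * cnj (maclaurin_coeff f n)) sums cnj (h2_inner f g)"
    using h2_inner_sums[OF assms, THEN sums_cnj[THEN iffD2]] by (simp add: mult.commute)
qed

lemma h2_norm_nonneg: "f \<in> H2 \<Longrightarrow> 0 \<le> h2_norm f"
  unfolding h2_norm_def by (simp add: suminf_nonneg H2_square_summable)

lemma h2_inner_self_eq_0:
  assumes "f \<in> H2" "h2_inner f f = 0"
  shows "maclaurin_coeff f n = 0"
proof -
  have "(\<lambda>n. Re (maclaurin_coeff f n * cnj (maclaurin_coeff f n))) sums Re 0"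
    using h2_inner_sums[OF assms(1,1)] assms(2) by (intro sums_Re) simp
  then have "(\<lambda>n. (cmod (maclaurin_coeff f n))\<^sup>2) sums 0"
    unfolding cmod_power2 by (simp add: power2_eq_square)
  then show ?thesis
    using suminf_eq_zero_iff[OF H2_square_summable[OF assms(1)]] by (auto simp: sums_iff)
qed

text \<open>The finite inequality for \<open>L2_set\<close> bounds every partial sum by the full
  norms, and the bound passes to the limit.\<close>

lemma h2_Cauchy_Schwarz:
  assumes "f \<in> H2" "g \<in> H2"
  shows "cmod (h2_inner f g) \<le> h2_norm f * h2_norm g"
proof (rule tendsto_upperbound)
  show "(\<lambda>N. cmod (\<Sum>n<N. maclaurin_coeff f n * cnj (maclaurin_coeff g n)))
      \<longlonglongrightarrow> cmod (h2_inner f g)"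
    using h2_inner_sums[OF assms] unfolding sums_def by (rule tendsto_norm)
  have L2: "L2_set (\<lambda>n. cmod (maclaurin_coeff k n)) {..<N} \<le> h2_norm k" if "k \<in> H2" for k N
    unfolding L2_set_def h2_norm_def
    by (intro real_sqrt_le_mono sum_le_suminf H2_square_summable that) auto
  have "cmod (\<Sum>n<N. maclaurin_coeff f n * cnj (maclaurin_coeff g n)) \<le> h2_norm f * h2_norm g" for N
  proof -
    have "cmod (\<Sum>n<N. maclaurin_coeff f n * cnj (maclaurin_coeff g n))
        \<le> (\<Sum>n<N. \<bar>cmod (maclaurin_coeff f n)\<bar> * \<bar>cmod (maclaurin_coeff g n)\<bar>)"
      by (rule order_trans[OF norm_sum]) (simp add: norm_mult)
    also have "\<dots> \<le> L2_set (\<lambda>n. cmod (maclaurin_coeff f n)) {..<N}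
        * L2_set (\<lambda>n. cmod (maclaurin_coeff g n)) {..<N}"
      by (rule L2_set_mult_ineq)
    also have "\<dots> \<le> h2_norm f * h2_norm g"
      by (intro mult_mono L2 assms h2_norm_nonneg L2_set_nonneg)
    finally show ?thesis .
  qed
  then show "\<forall>\<^sub>F N in sequentially. cmod (\<Sum>n<N. maclaurin_coeff f n * cnj (maclaurin_coeff g n))
      \<le> h2_norm f * h2_norm g" by simp
qed simp

section \<open>Truncations and Riesz representation\<close>

definition h2_truncate :: "nat \<Rightarrow> (nat \<Rightarrow> complex) \<Rightarrow> complex \<Rightarrow> complex" where
  "h2_truncate N a = h2_series (\<lambda>k. if k < N then a k else 0)"

lemma
  shows h2_truncate_in_H2: "h2_truncate N a \<in> H2"
    and maclaurin_coeff_h2_truncate: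
      "maclaurin_coeff (h2_truncate N a) n = (if n < N then a n else 0)"
proof -
  have *: "summable (\<lambda>k. (cmod (if k < N then a k else 0))\<^sup>2)"
    by (rule summable_finite[of "{..<N}"]) auto
  show "h2_truncate N a \<in> H2"
    "maclaurin_coeff (h2_truncate N a) n = (if n < N then a n else 0)"
    using h2_series_in_H2[OF *] maclaurin_coeff_h2_series[OF *] by (simp_all add: h2_truncate_def)
qed

text \<open>The representing element has coefficients \<open>cnj (L z\<^sup>n)\<close>; testing \<open>L\<close> against its own
  truncations bounds their norms by that of \<open>L\<close>.\<close>

lemma h2_Riesz:
  assumes lin: "\<And>c f d g. f \<in> H2 \<Longrightarrow> g \<in> H2 \<Longrightarrow> L (h2_lincomb c f d g) = c * L f + d * L g"
    and bdd: "\<And>f. f \<in> H2 \<Longrightarrow> cmod (L f) \<le> C * h2_norm f"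
  shows "\<exists>h\<in>H2. \<forall>f\<in>H2. L f = h2_inner f h"
proof -
  \<comment> \<open>The monomial \<open>z ^ n\<close>, obtained as a truncation so that its
    coefficients and membership in \<open>H2\<close> come for free; the cut at \<open>Suc n\<close>
    retains index \<open>n\<close>.\<close>
  define e where "e n = h2_truncate (Suc n) (\<lambda>k. if k = n then 1 else 0)" for n
  define b where "b n = cnj (L (e n))" for n
  have cnj_b: "cnj (b n) = L (e n)" for n by (simp add: b_def)
  have e_H2: "e n \<in> H2" and e_coeff: "maclaurin_coeff (e n) k = (if k = n then 1 else 0)" for n k
    by (auto simp: e_def h2_truncate_in_H2 maclaurin_coeff_h2_truncate)
  have L_truncate: "L (h2_truncate N a) = (\<Sum>k<N. a k * L (e k))" for N a
  proof (induction N)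
    case 0
    \<comment> \<open>Linearity is available only through \<open>h2_lincomb\<close>, so zero is
      written as a trivial combination to get value 0 under \<open>L\<close>.\<close>
    have "h2_truncate 0 a = h2_lincomb 0 (e 0) 0 (e 0)"
      by (intro H2_eqI_coeff h2_truncate_in_H2 h2_lincomb_in_H2 e_H2)
        (simp add: maclaurin_coeff_h2_truncate maclaurin_coeff_h2_lincomb e_H2)
    then show ?case by (simp add: lin e_H2)
  next
    case (Suc N)
    have "h2_truncate (Suc N) a = h2_lincomb 1 (h2_truncate N a) (a N) (e N)"
      by (intro H2_eqI_coeff h2_truncate_in_H2 h2_lincomb_in_H2 e_H2)
        (auto simp: maclaurin_coeff_h2_truncate maclaurin_coeff_h2_lincomb e_H2 e_coeff
          h2_truncate_in_H2 less_Suc_eq)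
    then show ?case by (simp add: lin e_H2 h2_truncate_in_H2 Suc)
  qed
  have "(\<Sum>k<N. (cmod (b k))\<^sup>2) \<le> C\<^sup>2" for N
  proof -
    define S where "S = (\<Sum>k<N. (cmod (b k))\<^sup>2)"
    have "S \<ge> 0" by (auto simp: S_def intro: sum_nonneg)
    have "b k * L (e k) = of_real ((cmod (b k))\<^sup>2)" for k
      by (metis b_def complex_cnj_cnj complex_norm_square)
    then have "L (h2_truncate N b) = of_real S"
      by (simp add: L_truncate S_def)
    then have "cmod (L (h2_truncate N b)) = S"
      using \<open>S \<ge> 0\<close> by simp
    moreover have "h2_norm (h2_truncate N b) = sqrt S"
    proof -
      have "(\<Sum>n. (cmod (if n < N then b n else 0))\<^sup>2) = S"
        unfolding S_def by (subst suminf_finite[of "{..<N}"]) auto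
      then show ?thesis by (simp add: h2_norm_def maclaurin_coeff_h2_truncate)
    qed
    ultimately have "sqrt S * sqrt S \<le> C * sqrt S"
      using bdd[OF h2_truncate_in_H2, of N b] \<open>S \<ge> 0\<close> by simp
    \<comment> \<open>Cancelling \<open>sqrt S\<close> requires it to be nonzero. If
      \<open>S = 0\<close>, the bound by the square of \<open>C\<close> is immediate whatever the
      sign of \<open>C\<close>.\<close>
    then have "S = 0 \<or> sqrt S \<le> C"
      using \<open>S \<ge> 0\<close> by (metis mult_le_cancel_right real_sqrt_eq_zero_cancel real_sqrt_ge_zero order_le_less)
    then show ?thesis
      using \<open>S \<ge> 0\<close> power_mono[of "sqrt S" C 2] unfolding S_def[symmetric] by auto
  qed
  then have b_sq: "summable (\<lambda>k. (cmod (b k))\<^sup>2)"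
    by (intro summableI_nonneg_bounded[where x = "C\<^sup>2"]) auto
  have "L f = h2_inner f (h2_series b)" if f: "f \<in> H2" for f
  proof -
    define a where "a = maclaurin_coeff f"
    \<comment> \<open>The tail of \<open>f\<close> from index \<open>N\<close> on. Its norm tends to
      0, so boundedness of \<open>L\<close> makes \<open>L f\<close> the limit of its values on
      truncations.\<close>
    define R where "R N = h2_lincomb 1 f (-1) (h2_truncate N a)" for N
    have a_sq: "summable (\<lambda>n. (cmod (a n))\<^sup>2)"
      unfolding a_def by (rule H2_square_summable[OF f])
    have R_H2: "R N \<in> H2" for N
      unfolding R_def by (intro h2_lincomb_in_H2 f h2_truncate_in_H2)
    have "h2_norm (R N) = sqrt (\<Sum>n. (cmod (a (n + N)))\<^sup>2)" for N
    proof -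
      have *: "(\<lambda>n. (cmod (maclaurin_coeff (R N) n))\<^sup>2) = (\<lambda>n. if n < N then 0 else (cmod (a n))\<^sup>2)"
        by (auto simp: R_def maclaurin_coeff_h2_lincomb f h2_truncate_in_H2
            maclaurin_coeff_h2_truncate a_def)
      show ?thesis
        using suminf_split_initial_segment[OF H2_square_summable[OF R_H2], of N N]
        unfolding h2_norm_def * by (simp add: fun_cong[OF *])
    qed
    moreover have "(\<lambda>N. \<Sum>n. (cmod (a (n + N)))\<^sup>2) \<longlonglongrightarrow> 0"
      using suminf_exist_split2[OF a_sq] by simp
    ultimately have "(\<lambda>N. h2_norm (R N)) \<longlonglongrightarrow> 0"
      using tendsto_real_sqrt by fastforce
    then have "(\<lambda>N. C * h2_norm (R N)) \<longlonglongrightarrow> 0"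
      by (rule tendsto_mult_right_zero)
    then have "(\<lambda>N. L (R N)) \<longlonglongrightarrow> 0"
      by (rule Lim_null_comparison[rotated]) (simp add: bdd R_H2)
    moreover have "L (R N) = L f - (\<Sum>k<N. a k * L (e k))" for N
      by (simp add: R_def lin f h2_truncate_in_H2 L_truncate)
    ultimately have "(\<lambda>N. L f - (L f - (\<Sum>k<N. a k * L (e k)))) \<longlonglongrightarrow> L f - 0"
      by (intro tendsto_diff tendsto_const) simp
    then have "(\<lambda>k. a k * L (e k)) sums L f"
      by (simp add: sums_def)
    moreover have "(\<lambda>k. a k * L (e k)) sums h2_inner f (h2_series b)"
      using h2_inner_sums[OF f h2_series_in_H2[OF b_sq]]
      by (simp add: maclaurin_coeff_h2_series[OF b_sq] a_def cnj_b)
    ultimately show ?thesis by (rule sums_unique2)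
  qed
  then show ?thesis using h2_series_in_H2[OF b_sq] by blast
qed

section \<open>Uniqueness and existence of adjoints\<close>

text \<open>Testing with \<open>f = g - h\<close> gives a vector of norm 0. This supplies the
  uniqueness behind the \<open>THE\<close> in \<open>h2_adjoint\<close>.\<close>

lemma h2_inner_right_cancel:
  assumes "g \<in> H2" "h \<in> H2" "\<And>f. f \<in> H2 \<Longrightarrow> h2_inner f g = h2_inner f h"
  shows "g = h"
proof (rule H2_eqI_coeff[OF assms(1,2)])
  fix n
  define k where "k = h2_lincomb 1 g (-1) h"
  have k: "k \<in> H2" unfolding k_def by (rule h2_lincomb_in_H2[OF assms(1,2)])
  have "h2_inner k k = cnj (h2_inner k g) - cnj (h2_inner k h)"
    using h2_inner_lincomb_left[OF assms(1,2) k, of 1 "-1"] h2_inner_commute[OF k] assms(1,2)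
    by (simp add: k_def)
  then have "maclaurin_coeff k n = 0"
    using h2_inner_self_eq_0[OF k] assms(3)[OF k] by simp
  then show "maclaurin_coeff g n = maclaurin_coeff h n"
    by (simp add: k_def maclaurin_coeff_h2_lincomb assms)
qed

lemma h2_adjoint_eqI:
  assumes "h \<in> H2" "\<And>f. f \<in> H2 \<Longrightarrow> h2_inner (T f) g = h2_inner f h"
  shows "h2_adjoint T g = h"
  unfolding h2_adjoint_def
  by (rule the_equality) (use assms in \<open>auto intro!: h2_inner_right_cancel\<close>)

text \<open>Riesz representation of the functional sending \<open>f\<close> to
  \<open>h2_inner (T f) g\<close>, which Cauchy-Schwarz bounds with constant
  \<open>C * h2_norm g\<close>.\<close>

lemma h2_adjoint_works:
  assumes bdd: "h2_bounded T"
    and lin: "\<And>c f d g. f \<in> H2 \<Longrightarrow> g \<in> H2 \<Longrightarrow>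
      T (h2_lincomb c f d g) = h2_lincomb c (T f) d (T g)"
    and g: "g \<in> H2"
  shows "h2_adjoint T g \<in> H2"
    and "f \<in> H2 \<Longrightarrow> h2_inner (T f) g = h2_inner f (h2_adjoint T g)"
proof -
  from bdd obtain C where T: "\<And>f. f \<in> H2 \<Longrightarrow> T f \<in> H2"
    and C: "\<And>f. f \<in> H2 \<Longrightarrow> h2_norm (T f) \<le> C * h2_norm f"
    by (auto simp: h2_bounded_def)
  have "\<exists>h\<in>H2. \<forall>f\<in>H2. h2_inner (T f) g = h2_inner f h"
  proof (rule h2_Riesz)
    show "cmod (h2_inner (T f) g) \<le> (C * h2_norm g) * h2_norm f" if "f \<in> H2" for f
      using h2_Cauchy_Schwarz[OF T[OF that] g] mult_right_mono[OF C[OF that] h2_norm_nonneg[OF g]]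
      by (simp add: algebra_simps)
  qed (simp add: lin T g h2_inner_lincomb_left)
  then obtain h where h: "h \<in> H2" "\<And>f. f \<in> H2 \<Longrightarrow> h2_inner (T f) g = h2_inner f h"
    by blast
  then have "h2_adjoint T g = h" by (rule h2_adjoint_eqI)
  with h show "h2_adjoint T g \<in> H2" "f \<in> H2 \<Longrightarrow> h2_inner (T f) g = h2_inner f (h2_adjoint T g)"
    by auto
qed

section \<open>Reproducing kernels\<close>

text \<open>The Szego kernel \<open>1 / (1 - cnj w * z)\<close>, given by its geometric series so
  that its coefficients can be read off.\<close>

definition h2_kernel :: "complex \<Rightarrow> complex \<Rightarrow> complex" where
  "h2_kernel w = h2_series (\<lambda>n. cnj w ^ n)"

lemma
  assumes "w \<in> unit_disc"
  shows h2_kernel_in_H2: "h2_kernel w \<in> H2"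
    and maclaurin_coeff_h2_kernel: "maclaurin_coeff (h2_kernel w) n = cnj w ^ n"
proof -
  have "(cmod w)\<^sup>2 < 1"
    using assms by (simp add: power_less_one_iff abs_square_less_1)
  then have "summable (\<lambda>n. ((cmod w)\<^sup>2) ^ n)"
    by (intro summable_geometric) simp
  then have *: "summable (\<lambda>n. (cmod (cnj w ^ n))\<^sup>2)"
    by (simp add: norm_power mult.commute flip: power_mult)
  show "h2_kernel w \<in> H2" "maclaurin_coeff (h2_kernel w) n = cnj w ^ n"
    using h2_series_in_H2[OF *] maclaurin_coeff_h2_series[OF *] by (simp_all add: h2_kernel_def)
qed

text \<open>The reproducing property: conjugating \<open>cnj w ^ n\<close> turns the inner product
  series into the Maclaurin series of \<open>f\<close> at \<open>w\<close>.\<close>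

lemma h2_inner_kernel:
  assumes "f \<in> H2" "w \<in> unit_disc"
  shows "h2_inner f (h2_kernel w) = f w"
  using h2_inner_sums[OF assms(1) h2_kernel_in_H2[OF assms(2)]] H2_sums[OF assms]
  by (intro sums_unique2) (simp_all add: maclaurin_coeff_h2_kernel[OF assms(2)])

lemma h2_inner_lincomb_right:
  assumes "f \<in> H2" "g \<in> H2" "h \<in> H2"
  shows "h2_inner h (h2_lincomb c f d g) = cnj c * h2_inner h f + cnj d * h2_inner h g"
  unfolding h2_inner_commute[OF h2_lincomb_in_H2[OF assms(1,2)] assms(3)]
    h2_inner_commute[OF assms(1,3)] h2_inner_commute[OF assms(2,3)]
    h2_inner_lincomb_left[OF assms]
  by simp

section \<open>Univalence of the composition symbol\<close>

theorem proposition3: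
  fixes \<phi> \<psi> :: "complex \<Rightarrow> complex"
  assumes "\<phi> holomorphic_on unit_disc"
    and "\<phi> ` unit_disc \<subseteq> unit_disc"
    and "\<psi> holomorphic_on unit_disc"
    and "h2_bounded (weighted_comp_op \<psi> \<phi>)"
    and "h2_normal (weighted_comp_op \<psi> \<phi>)"
    and "\<not> \<phi> constant_on unit_disc"
    and "\<exists>z\<in>unit_disc. \<psi> z \<noteq> 0"
  shows "inj_on \<phi> unit_disc"
proof -
  define T where "T = weighted_comp_op \<psi> \<phi>"
  \<comment> \<open>The zero vector of \<open>H2\<close>. It is undefined off the disc, so the
    constant function 0 on the whole plane would not do.\<close>
  define Z where "Z = h2_truncate 0 (\<lambda>_. 0)"
  have T_apply: "T f z = \<psi> z * f (\<phi> z)" if "z \<in> unit_disc" for f z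
    using that by (simp add: T_def weighted_comp_op_def)
  have \<phi>_disc: "\<phi> z \<in> unit_disc" if "z \<in> unit_disc" for z
    using assms(2) that by blast
  have T_H2: "T f \<in> H2" if "f \<in> H2" for f
    using assms(4) that by (auto simp: T_def h2_bounded_def)
  have T_lin: "T (h2_lincomb c f d g) = h2_lincomb c (T f) d (T g)"
    if "f \<in> H2" "g \<in> H2" for c f d g
  proof (rule H2_eqI)
    show "T (h2_lincomb c f d g) z = h2_lincomb c (T f) d (T g) z" if "z \<in> unit_disc" for z
      using that \<phi>_disc[OF that] by (simp add: T_apply h2_lincomb_def algebra_simps)
  qed (simp_all add: that T_H2 h2_lincomb_in_H2)
  have Z_H2: "Z \<in> H2" and Z_coeff: "maclaurin_coeff Z n = 0" for n
    by (simp_all add: Z_def h2_truncate_in_H2 maclaurin_coeff_h2_truncate)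
  have Z_apply: "Z z = 0" if "z \<in> unit_disc" for z
    using H2_sums[OF Z_H2 that] by (simp add: Z_coeff sums_iff)
  have TZ: "T Z = Z"
    by (rule H2_eqI) (use \<phi>_disc in \<open>auto simp: T_H2 Z_H2 T_apply Z_apply\<close>)

  have T_inj: "f = Z" if f: "f \<in> H2" and Tf: "T f = Z" for f
  proof -
    obtain z0 where z0: "z0 \<in> unit_disc" "\<psi> z0 \<noteq> 0" using assms(7) by blast
    \<comment> \<open>On this nonempty open set \<psi> can be cancelled from \<open>T f = Z\<close>,
      so \<open>f\<close> vanishes on the open image of \<open>U\<close> under \<phi>.\<close>
    define U where "U = unit_disc \<inter> \<psi> -` (- {0})"
    have U: "open U"
      unfolding U_def using assms(3)
      by (intro continuous_open_preimage holomorphic_on_imp_continuous_on) auto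
    have opn: "open (\<phi> ` U)"
      using assms(1,6) U by (intro open_mapping_thm[of \<phi> unit_disc]) (auto simp: U_def)
    show ?thesis
    proof (rule H2_eqI[OF f Z_H2])
      fix z assume z: "z \<in> unit_disc"
      have "f z = 0"
      proof (rule analytic_continuation_open[of "\<phi> ` U" unit_disc f "\<lambda>_. 0"])
        have "f (\<phi> x) = 0" if "x \<in> U" for x
          using that T_apply[of x f] Z_apply[of x] unfolding Tf by (simp add: U_def)
        then show "f w = 0" if "w \<in> \<phi> ` U" for w
          using that by blast
      qed (use opn z0 f z \<phi>_disc in \<open>auto simp: U_def H2_def\<close>)
      then show "f z = Z z" using Z_apply z by simp
    qed
  qed

  text \<open>Normality turns \<open>T\<^sup>* f = 0\<close> into \<open>T\<^sup>* (T f) = T (T\<^sup>* f) = 0\<close>,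
    whence \<open>\<langle>T f, T f\<rangle> = 0\<close>.\<close>
  have adj_inj: "f = Z" if f: "f \<in> H2" and orth: "\<And>g. g \<in> H2 \<Longrightarrow> h2_inner (T g) f = 0" for f
  proof -
    have inner_Z: "h2_inner g Z = 0" for g
      by (simp add: h2_inner_def Z_coeff)
    \<comment> \<open>Orthogonality to the range of \<open>T\<close> says exactly that
      \<open>Z\<close> meets the defining condition of the adjoint at \<open>f\<close>.\<close>
    have "h2_adjoint T f = Z"
      by (rule h2_adjoint_eqI) (simp_all add: Z_H2 orth inner_Z)
    moreover have "T (h2_adjoint T f) = h2_adjoint T (T f)"
      using assms(5) f by (simp add: h2_normal_def T_def)
    ultimately have "h2_adjoint T (T f) = Z"
      using TZ by simp
    \<comment> \<open>Here existence of the adjoint matters: normality only identifies the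
      \<open>THE\<close> term with \<open>Z\<close>, and Riesz ensures that this term satisfies the
      adjoint identity.\<close>
    moreover have "h2_inner (T f) (T f) = h2_inner f (h2_adjoint T (T f))"
      by (rule h2_adjoint_works(2)) (use assms(4) f in \<open>simp_all add: T_lin T_H2 flip: T_def\<close>)
    ultimately have "h2_inner (T f) (T f) = 0"
      by (simp only: inner_Z)
    then have "maclaurin_coeff (T f) n = 0" for n
      by (rule h2_inner_self_eq_0[OF T_H2[OF f]])
    then have "T f = Z"
      by (intro H2_eqI_coeff T_H2 f Z_H2) (simp add: Z_coeff)
    then show ?thesis by (rule T_inj[OF f])
  qed

  have \<psi>_nz: "\<psi> w \<noteq> 0" if w: "w \<in> unit_disc" for w
  proof
    assume "\<psi> w = 0"
    \<comment> \<open>By the reproducing property this inner product is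
      \<open>T g w = \<psi> w * g (\<phi> w)\<close>.\<close>
    then have "h2_inner (T g) (h2_kernel w) = 0" if "g \<in> H2" for g
      by (simp only: h2_inner_kernel[OF T_H2[OF that] w] T_apply[OF w]) simp
    then have "h2_kernel w = Z"
      by (rule adj_inj[OF h2_kernel_in_H2[OF w]])
    then show False
      \<comment> \<open>The constant coefficient of a kernel is 1, also for \<open>w = 0\<close>, so
        no kernel is zero.\<close>
      using maclaurin_coeff_h2_kernel[OF w, of 0] Z_coeff[of 0] by simp
  qed

  show ?thesis
  proof (rule inj_onI)
    fix a b assume a: "a \<in> unit_disc" and b: "b \<in> unit_disc" and eq: "\<phi> a = \<phi> b"
    \<comment> \<open>Weights chosen to cancel: \<open>h2_inner (T g) f\<close> becomes
      \<open>\<psi> b * \<psi> a * g (\<phi> a) - \<psi> a * \<psi> b * g (\<phi> b)\<close>, which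
      is 0 since \<open>\<phi> a = \<phi> b\<close>.\<close>
    define f where "f = h2_lincomb (cnj (\<psi> b)) (h2_kernel a) (- cnj (\<psi> a)) (h2_kernel b)"
    have "f \<in> H2"
      unfolding f_def by (intro h2_lincomb_in_H2 h2_kernel_in_H2 a b)
    moreover have "h2_inner (T g) f = 0" if "g \<in> H2" for g
      using h2_inner_kernel[OF T_H2[OF that]] a b
      by (simp add: f_def h2_inner_lincomb_right h2_kernel_in_H2 T_H2 that T_apply eq)
    ultimately have "f = Z" by (rule adj_inj)
    then have "maclaurin_coeff f n = 0" for n
      by (simp add: Z_coeff)
    then have coeff: "cnj (\<psi> b) * cnj a ^ n = cnj (\<psi> a) * cnj b ^ n" for n
      unfolding f_def maclaurin_coeff_h2_lincomb[OF h2_kernel_in_H2[OF a] h2_kernel_in_H2[OF b]]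
        maclaurin_coeff_h2_kernel[OF a] maclaurin_coeff_h2_kernel[OF b]
      by simp
    \<comment> \<open>Two coefficients suffice: index 0 equates the weights, and index 1 then
      separates the points, as \<psi> has no zeros.\<close>
    have "\<psi> b = \<psi> a"
      using coeff[of 0] by simp
    then have "\<psi> a * a = \<psi> a * b"
      using arg_cong[OF coeff[of 1], of cnj] by simp
    then show "a = b"
      using \<psi>_nz[OF a] by simp
  qed
qed

end
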